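(* Let $R$ be a commutative ring which is free as an abelian group with $\mathbb{Z}$-basis $V$, let $p$ be a prime, $n\ge2$ and $r\ge1$. Then there is a group epimorphism $\varphi_r:\Gamma(SL_n(R),p^r)\to\mathfrak{sl}_n(\mathbb{F}_p[V])$ (target regarded as an additive group) whose kernel is $\Gamma(SL_n(R),p^{r+1})$. Consequently $\Gamma(SL_n(R),p^r)/\Gamma(SL_n(R),p^{r+1})\cong\mathfrak{sl}_n(\mathbb{F}_p[V])$ as groups.
   Context: $\Gamma(SL_n(R),p^m)=\ker\big(SL_n(R)\to SL_n(R\otimes_{\mathbb{Z}}\mathbb{Z}/p^m)\big)$. $\mathbb{F}_p[V]=R\otimes_{\mathbb{Z}}\mathbb{Z}/p=R/pR$, and $\mathfrak{sl}_n(\mathbb{F}_p[V])$ is the set of traceless $n\times n$ matrices over $R/pR$. *)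

theory Defs
  imports "HOL-Analysis.Determinants" "HOL-Algebra.QuotRing" "HOL-Computational_Algebra.Primes"
begin

text \<open>R is free as an abelian group with Z-basis V: every element is uniquely a
  finitely supported Z-linear combination of elements of V.\<close>
definition free_Z_basis :: "'a::comm_ring_1 set \<Rightarrow> bool" where
  "free_Z_basis V \<longleftrightarrow>
     (\<forall>x::'a. \<exists>!c::'a \<Rightarrow> int. finite {v. c v \<noteq> 0} \<and> (\<forall>v. c v \<noteq> 0 \<longrightarrow> v \<in> V) \<and>
        x = (\<Sum>v\<in>{v. c v \<noteq> 0}. of_int (c v) * v))"

text \<open>The ring R (a type of class comm_ring_1) as a HOL-Algebra ring record.\<close>
definition ring_of_type :: "'a::comm_ring_1 ring" where
  "ring_of_type = \<lparr>carrier = UNIV, mult = (*), one = 1, zero = 0, add = (+)\<rparr>"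

text \<open>F_p[V] = R/pR\<close>
definition mod_p_ring :: "nat \<Rightarrow> ('a::comm_ring_1) set ring" where
  "mod_p_ring p = ring_of_type Quot {of_nat p * y | y. True}"

text \<open>Congruence subgroup Gamma(SL_n(R), m): det = 1 and A = I mod m R (entrywise).\<close>
definition congruence_subgroup :: "nat \<Rightarrow> ('a::comm_ring_1 ^'n::finite^'n) monoid" where
  "congruence_subgroup m =
     \<lparr>carrier = {A. det A = 1 \<and> (\<forall>i j. \<exists>b. (A - mat 1) $ i $ j = of_nat m * b)},
      mult = (**), one = mat 1\<rparr>"

text \<open>Additive group of traceless n x n matrices over a ring S.\<close>
definition sl_add_group :: "('b, 'c) ring_scheme \<Rightarrow> ('n::finite \<Rightarrow> 'n \<Rightarrow> 'b) monoid" where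
  "sl_add_group S =
     \<lparr>carrier = {M. (\<forall>i j. M i j \<in> carrier S) \<and> finsum S (\<lambda>i. M i i) UNIV = \<zero>\<^bsub>S\<^esub>},
      mult = (\<lambda>M N i j. M i j \<oplus>\<^bsub>S\<^esub> N i j), one = (\<lambda>i j. \<zero>\<^bsub>S\<^esub>)\<rparr>"

end

theory Submission
  imports Defs "HOL-Decision_Procs.Algebra_Aux"
begin

text \<open>Every \<open>A \<in> \<Gamma>(p\<^sup>r)\<close> is \<open>I + t X\<close> with \<open>t = p\<^sup>r\<close>, and \<open>X\<close> is unique because a free
  \<open>\<int>\<close>-module is torsion-free; \<open>\<phi>\<^sub>r\<close> sends \<open>A\<close> to \<open>X mod p\<close>. It is a homomorphism since
  \<open>(I + t X)(I + t Y) = I + t (X + Y + t X Y)\<close> and \<open>p\<close> divides \<open>t\<close>, and it lands in the traceless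
  matrices because \<open>det (I + t X) \<equiv> 1 + t tr X\<close> modulo \<open>t\<^sup>2\<close>. Its kernel consists of the \<open>I + t X\<close>
  with \<open>p | X\<close>, which is \<open>\<Gamma>(p\<^sup>r\<^sup>+\<^sup>1)\<close>. It is onto because the transvections
  \<open>I + t c E\<^sub>i\<^sub>j\<close> and the unipotent matrices \<open>I + t c (E\<^sub>i\<^sub>i - E\<^sub>j\<^sub>j + E\<^sub>i\<^sub>j - E\<^sub>j\<^sub>i)\<close>
  (\<open>i \<noteq> j\<close>) lie in \<open>\<Gamma>(p\<^sup>r)\<close> and their images generate \<open>sl\<^sub>n(\<bbbF>\<^sub>p[V])\<close>; the isomorphism is then
  the first isomorphism theorem.\<close>

section \<open>Reduction modulo \<open>q\<close>\<close>

lemma ring_of_type_eq_cring_class_ops: "ring_of_type = cring_class_ops"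
  by (simp add: ring_of_type_def cring_class_ops_def)

definition residue_class :: "nat \<Rightarrow> 'a::comm_ring_1 \<Rightarrow> 'a set" where
  "residue_class q x = {of_nat q * y | y. True} +>\<^bsub>ring_of_type\<^esub> x"

lemma ideal_multiples: "ideal {of_nat q * y | y. True} (ring_of_type :: 'a::comm_ring_1 ring)"
proof -
  have "{of_nat q * y | y. True} = PIdl\<^bsub>cring_class_ops\<^esub> (of_nat q :: 'a)"
    by (auto simp: cgenideal_def class_simps mult.commute)
  then show ?thesis
    using cring.cgenideal_ideal[OF cring_class] by (simp add: ring_of_type_eq_cring_class_ops class_simps)
qed

lemma residue_class_hom:
  "ring_hom_cring ring_of_type (mod_p_ring q) (residue_class q :: 'a::comm_ring_1 \<Rightarrow> _)"
  using ideal.rcos_ring_hom_cring[OF ideal_multiples, of q] cring_class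
  by (simp add: mod_p_ring_def residue_class_def[abs_def] ring_of_type_eq_cring_class_ops)

lemma cring_mod_p_ring: "cring (mod_p_ring q :: 'a::comm_ring_1 set ring)"
  using residue_class_hom by (rule ring_hom_cring.axioms)

lemma residue_class_eq_iff:
  "residue_class q x = residue_class q y \<longleftrightarrow> of_nat q dvd (x - y :: 'a::comm_ring_1)"
  using ring.quotient_eq_iff_same_a_r_cos[OF cring_class.ring_axioms
      ideal_multiples[of q, unfolded ring_of_type_eq_cring_class_ops], of x y]
  by (auto simp: residue_class_def ring_of_type_eq_cring_class_ops class_simps dvd_def)

lemma residue_class_zero: "residue_class q (0 :: 'a::comm_ring_1) = \<zero>\<^bsub>mod_p_ring q\<^esub>"
proof -
  interpret ring_hom_cring ring_of_type "mod_p_ring q" "residue_class q :: 'a \<Rightarrow> _"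
    by (rule residue_class_hom)
  show ?thesis using hom_zero by (simp add: ring_of_type_eq_cring_class_ops class_simps)
qed

lemma residue_class_add:
  "residue_class q (x + y) = residue_class q x \<oplus>\<^bsub>mod_p_ring q\<^esub> residue_class q (y :: 'a::comm_ring_1)"
proof -
  interpret ring_hom_cring ring_of_type "mod_p_ring q" "residue_class q :: 'a \<Rightarrow> _"
    by (rule residue_class_hom)
  show ?thesis using hom_add by (simp add: ring_of_type_eq_cring_class_ops class_simps)
qed

lemma carrier_mod_p_ring: "carrier (mod_p_ring q) = range (residue_class q :: 'a::comm_ring_1 \<Rightarrow> _)"
  by (auto simp: mod_p_ring_def residue_class_def FactRing_def A_RCOSETS_def' ring_of_type_def)

lemma residue_class_sum:
  assumes "finite A"
  shows "finsum (mod_p_ring q) (\<lambda>i. residue_class q (f i)) A = residue_class q (sum f A :: 'a::comm_ring_1)"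
  using assms
proof (induction A rule: finite_induct)
  case empty
  interpret cring "mod_p_ring q :: 'a set ring" by (rule cring_mod_p_ring)
  show ?case by (simp add: residue_class_zero)
next
  case (insert i A)
  interpret cring "mod_p_ring q :: 'a set ring" by (rule cring_mod_p_ring)
  show ?case
    using insert by (simp add: finsum_insert carrier_mod_p_ring residue_class_add)
qed

lemma free_Z_basis_torsion_free:
  assumes V: "free_Z_basis (V :: 'a::comm_ring_1 set)" and "k > 0" and kx: "of_nat k * x = (0::'a)"
  shows "x = 0"
proof -
  define coordinates where "coordinates y c \<longleftrightarrow> finite {v. c v \<noteq> 0} \<and> (\<forall>v. c v \<noteq> 0 \<longrightarrow> v \<in> V) \<and>
      y = (\<Sum>v\<in>{v. c v \<noteq> 0}. of_int (c v) * v)" for y :: 'a and c :: "'a \<Rightarrow> int"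
  have unique: "\<exists>!c. coordinates y c" for y
    using V unfolding free_Z_basis_def coordinates_def by blast
  obtain c where c: "coordinates x c" using unique by blast
  have support: "{v. int k * c v \<noteq> 0} = {v. c v \<noteq> 0}"
    using \<open>k > 0\<close> by auto
  have "(\<Sum>v\<in>{v. c v \<noteq> 0}. of_int (int k * c v) * v) = of_nat k * x"
    using c by (simp add: coordinates_def sum_distrib_left mult.assoc)
  then have "coordinates 0 (\<lambda>v. int k * c v)"
    using c kx by (simp add: coordinates_def support \<open>k > 0\<close>)
  moreover have "coordinates 0 (\<lambda>_. 0)" by (simp add: coordinates_def)
  ultimately have "(\<lambda>v. int k * c v) = (\<lambda>_. 0)" using unique by blast
  then have "{v. c v \<noteq> 0} = {}" using \<open>k > 0\<close> by (auto simp: fun_eq_iff)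
  then show ?thesis using c by (simp add: coordinates_def)
qed

lemma free_Z_basis_inj_mult_of_nat:
  assumes "free_Z_basis (V :: 'a::comm_ring_1 set)" and "k > 0"
  shows "inj ((*) (of_nat k :: 'a))"
  by (rule injI) (use free_Z_basis_torsion_free[OF assms, of "_ - _"] in \<open>simp add: right_diff_distrib\<close>)

section \<open>Matrices near the identity\<close>

lemma matrix_add_rdistrib: "(A + B) ** C = A ** C + B ** (C :: 'a::semiring_1^'p^'n)"
  by (vector matrix_matrix_mult_def sum.distrib[symmetric] distrib_right)

lemma mat_nth [simp]: "mat c $ i $ j = (if i = j then c else 0)"
  by (simp add: mat_def)

lemma mat_matrix_mult_nth [simp]: "(mat c ** A) $ i $ j = c * A $ i $ (j :: 'n::finite)"
  by (simp add: matrix_matrix_mult_def mat_def if_distrib[where f="\<lambda>x. x * _"] cong: if_cong)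

lemma matrix_mult_mat_commute: "A ** (mat c ** B) = mat c ** (A ** (B :: 'a::comm_semiring_1^'p^'n))"
  by (simp add: vec_eq_iff matrix_matrix_mult_def[of A "mat c ** B"] matrix_matrix_mult_def[of A B]
      sum_distrib_left mult.left_commute)

lemma mat_mult_matrix_mult: "mat (a * b) ** A = mat a ** (mat b ** (A :: 'a::semiring_1^'p^'n::finite))"
  by (simp add: vec_eq_iff mult.assoc)

lemma mat_matrix_mult_left_cancel:
  assumes "inj ((*) c)" and "mat c ** A = mat c ** (B :: 'a::semiring_1^'p^'n::finite)"
  shows "A = B"
proof -
  have "c * A $ i $ j = c * B $ i $ j" for i j
    using arg_cong[OF assms(2), of "\<lambda>M. M $ i $ j"] by simp
  then show ?thesis using assms(1) by (simp add: vec_eq_iff inj_def)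
qed

lemma entrywise_dvd_iff_mat_mult:
  "(\<forall>i j. c dvd A $ i $ j) \<longleftrightarrow> (\<exists>B. A = mat c ** (B :: 'a::comm_semiring_1^'p^'n::finite))"
proof
  assume "\<forall>i j. c dvd A $ i $ j"
  then have entry: "A $ i $ j = c * (SOME b. A $ i $ j = c * b)" for i j
    unfolding dvd_def by (intro someI_ex[of "\<lambda>b. A $ i $ j = c * b"]) blast
  have "A = mat c ** (\<chi> i j. SOME b. A $ i $ j = c * b)"
    by (auto simp: vec_eq_iff intro: entry)
  then show "\<exists>B. A = mat c ** B" ..
next
  assume "\<exists>B. A = mat c ** B"
  then obtain B where "A = mat c ** B" ..
  then show "\<forall>i j. c dvd A $ i $ j" by (simp add: dvd_triv_left)
qed

lemma mat_1_plus_mult: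
  fixes X Y :: "'a::comm_ring_1^'n::finite^'n"
  shows "(mat 1 + mat t ** X) ** (mat 1 + mat t ** Y) = mat 1 + mat t ** (X + Y + mat t ** (X ** Y))"
proof -
  have "(mat t ** X) ** (mat t ** Y) = mat t ** (mat t ** (X ** Y))"
    by (metis matrix_mult_mat_commute matrix_mul_assoc)
  then show ?thesis
    by (simp add: matrix_add_ldistrib matrix_add_rdistrib add_ac)
qed

definition adjugate :: "'a::comm_ring_1^'n::finite^'n \<Rightarrow> 'a^'n^'n" where
  "adjugate A = (\<chi> k j. det (\<chi> i. if i = j then axis k 1 else row i A))"

lemma matrix_mult_adjugate: "A ** adjugate A = mat (det (A :: 'a::comm_ring_1^'n::finite^'n))"
proof -
  have "(A ** adjugate A) $ i $ j = (if i = j then det A else 0)" for i j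
  proof -
    have "(A ** adjugate A) $ i $ j = (\<Sum>k\<in>UNIV. det (\<chi> l. if l = j then A$i$k *s axis k 1 else row l A))"
      by (simp add: matrix_matrix_mult_def adjugate_def det_row_mul)
    also have "\<dots> = det (\<chi> l. if l = j then (\<Sum>k\<in>UNIV. A$i$k *s axis k 1) else row l A)"
      using det_linear_row_sum[of UNIV j "\<lambda>l k. A$i$k *s axis k 1" "\<lambda>l. row l A"] by simp
    also have "(\<Sum>k\<in>UNIV. A$i$k *s axis k 1) = row i A"
      by (simp add: vec_eq_iff row_def axis_def sum_component if_distrib cong: if_cong)
    also have "det (\<chi> l. if l = j then row i A else row l A) = (if i = j then det A else 0)"
    proof (cases "i = j")
      case True
      have "(\<chi> l. if l = j then row i A else row l A) = A"
        using True by (simp add: row_def vec_eq_iff)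
      then show ?thesis using True by simp
    next
      case False
      show ?thesis
        using False by (simp, intro det_identical_rows[of i j]) (auto simp: row_def vec_eq_iff)
    qed
    finally show ?thesis .
  qed
  then show ?thesis by (simp add: vec_eq_iff mat_def)
qed

lemma det_eq_1_imp_left_inverse:
  assumes "det (A :: 'a::comm_ring_1^'n::finite^'n) = 1"
  obtains B where "det B = 1" and "B ** A = mat 1"
proof
  let ?B = "transpose (adjugate (transpose A))"
  have "transpose A ** adjugate (transpose A) = mat 1"
    using assms by (simp add: matrix_mult_adjugate)
  then show BA: "?B ** A = mat 1"
    by (metis matrix_transpose_mul transpose_mat transpose_transpose)
  then have "det ?B * det A = 1" by (metis det_I det_mul)
  then show "det ?B = 1" using assms by simp
qed

lemma prod_one_plus_mult_cong:
  fixes t :: "'a::comm_ring_1"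
  assumes "finite S"
  shows "t * t dvd (\<Prod>i\<in>S. 1 + t * a i) - 1 - t * sum a S"
  using assms
proof (induction S rule: finite_induct)
  case empty
  then show ?case by simp
next
  case (insert x F)
  then obtain c where c: "(\<Prod>i\<in>F. 1 + t * a i) = 1 + t * sum a F + t * t * c"
    by (auto simp: dvd_def algebra_simps)
  have "(\<Prod>i\<in>insert x F. 1 + t * a i) - 1 - t * sum a (insert x F)
        = t * t * (c + a x * sum a F + t * a x * c)"
    using insert by (simp add: c algebra_simps)
  then show ?case by simp
qed

lemma prod_dvd_of_two_moved_points:
  assumes "p permutes (UNIV :: 'n::finite set)" and "p \<noteq> id" and "\<And>i. p i \<noteq> i \<Longrightarrow> t dvd f i"
  shows "t * t dvd (\<Prod>i\<in>UNIV. f i :: 'a::comm_ring_1)"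
proof -
  from \<open>p \<noteq> id\<close> obtain i where i: "p i \<noteq> i" by (auto simp: fun_eq_iff)
  have j: "p (p i) \<noteq> p i"
    using i permutes_inj[OF assms(1)] by (auto dest: injD)
  have "(\<Prod>k\<in>UNIV. f k) = f i * (\<Prod>k\<in>UNIV - {i}. f k)"
    by (rule prod.remove) simp_all
  also have "(\<Prod>k\<in>UNIV - {i}. f k) = f (p i) * (\<Prod>k\<in>UNIV - {i} - {p i}. f k)"
    by (rule prod.remove) (use i in auto)
  finally show ?thesis
    using assms(3)[OF i] assms(3)[OF j] by (simp add: mult_dvd_mono mult.assoc[symmetric])
qed

lemma det_mat_1_plus_mult_cong:
  fixes X :: "'a::comm_ring_1^'n::finite^'n"
  shows "t * t dvd det (mat 1 + mat t ** X) - 1 - t * trace X"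
proof -
  let ?A = "mat 1 + mat t ** X"
  let ?g = "\<lambda>p. of_int (sign p) * (\<Prod>i\<in>UNIV. ?A $ i $ p i)"
  let ?P = "{p. p permutes (UNIV :: 'n set)}"
  have det: "det ?A = ?g id + sum ?g (?P - {id})"
    unfolding det_def by (rule sum.remove) (simp_all add: finite_permutations)
  have "?g id = (\<Prod>i\<in>UNIV. 1 + t * X $ i $ i)"
    by (simp add: sign_id)
  then have diagonal: "t * t dvd ?g id - 1 - t * trace X"
    using prod_one_plus_mult_cong[of UNIV t "\<lambda>i. X $ i $ i"] by (simp add: trace_def)
  have "t * t dvd ?g p" if "p \<in> ?P - {id}" for p
    using that by (intro dvd_mult prod_dvd_of_two_moved_points[of p]) auto
  then have "t * t dvd sum ?g (?P - {id})" by (rule dvd_sum)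
  with diagonal have "t * t dvd (?g id - 1 - t * trace X) + sum ?g (?P - {id})"
    by (rule dvd_add)
  then show ?thesis
    unfolding det by (simp add: algebra_simps)
qed

definition matrix_unit :: "'n \<Rightarrow> 'n \<Rightarrow> 'a::zero \<Rightarrow> 'a^'n::finite^'n" where
  "matrix_unit i j c = (\<chi> a b. if a = i \<and> b = j then c else 0)"

lemma matrix_unit_nth [simp]: "matrix_unit i j c $ a $ b = (if a = i \<and> b = j then c else 0)"
  by (simp add: matrix_unit_def)

lemma mat_mult_matrix_unit: "mat t ** matrix_unit i j c = matrix_unit i j (t * c :: 'a::semiring_1)"
  by (simp add: vec_eq_iff)

lemma sum_matrix_units_nth:
  "(\<Sum>s\<in>S. matrix_unit (fst s) (snd s) (f s) :: 'a::comm_monoid_add^'n::finite^'n) $ a $ b =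
    (if (a, b) \<in> S then f (a, b) else 0)"
proof -
  have "(\<Sum>s\<in>S. matrix_unit (fst s) (snd s) (f s) :: 'a^'n^'n) $ a $ b
      = (\<Sum>s\<in>S. if a = fst s \<and> b = snd s then f s else 0)"
    by (simp add: sum_component)
  also have "\<dots> = (\<Sum>s\<in>S. if s = (a, b) then f s else 0)"
    by (rule sum.cong) auto
  also have "\<dots> = (if (a, b) \<in> S then f (a, b) else 0)"
    by (simp add: sum.delta)
  finally show ?thesis .
qed

lemma det_mat_1_plus_matrix_unit:
  assumes "i \<noteq> j"
  shows "det (mat 1 + matrix_unit i j c :: 'a::comm_ring_1^'n::finite^'n) = 1"
proof -
  have "mat 1 + matrix_unit i j c =
      (\<chi> k. if k = i then row i (mat 1) + c *s row j (mat 1) else row k (mat 1))"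
    using assms by (auto simp: vec_eq_iff row_def)
  then show ?thesis using det_row_operation[OF assms, where c=c and A="mat 1"] by simp
qed

lemma det_mat_1_plus_square_zero:
  fixes c :: "'a::comm_ring_1"
  assumes ij: "i \<noteq> j"
  defines "N \<equiv> matrix_unit i i c - matrix_unit j j c + matrix_unit i j c - matrix_unit j i c :: 'a^'n::finite^'n"
  shows "det (mat 1 + N) = 1"
proof -
  let ?A = "mat 1 + N"
  define A1 where "A1 = (\<chi> k. if k = i then row i ?A + 1 *s row j ?A else row k ?A)"
  define A2 where "A2 = (\<chi> k. if k = j then row j A1 + c *s row i A1 else row k A1)"
  define A3 where "A3 = (\<chi> k. if k = i then row i A2 + (-1) *s row j A2 else row k A2)"
  have "det A1 = det ?A" unfolding A1_def by (rule det_row_operation[OF ij])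
  moreover have "det A2 = det A1" unfolding A2_def by (rule det_row_operation[OF ij[symmetric]])
  moreover have "det A3 = det A2" unfolding A3_def by (rule det_row_operation[OF ij])
  moreover have "A3 = mat 1"
    using ij by (auto simp: vec_eq_iff A3_def A2_def A1_def N_def row_def)
  ultimately show ?thesis by simp
qed

section \<open>Congruence subgroups\<close>

lemma congruence_subgroup_iff:
  "A \<in> carrier (congruence_subgroup m) \<longleftrightarrow>
     det A = 1 \<and> (\<exists>X. A = mat 1 + mat (of_nat m) ** (X :: 'a::comm_ring_1^'n::finite^'n))"
proof -
  have "(\<forall>i j. \<exists>b. (A - mat 1) $ i $ j = of_nat m * b) \<longleftrightarrow> (\<forall>i j. of_nat m dvd (A - mat 1) $ i $ j)"
    by (simp add: dvd_def eq_commute)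
  also have "\<dots> \<longleftrightarrow> (\<exists>X. A - mat 1 = mat (of_nat m) ** X)"
    by (rule entrywise_dvd_iff_mat_mult)
  finally show ?thesis
    by (simp add: congruence_subgroup_def diff_eq_eq add.commute)
qed

lemma congruence_subgroup_simps [simp]:
  "mult (congruence_subgroup m) = (**)" "one (congruence_subgroup m) = mat 1"
  by (simp_all add: congruence_subgroup_def)

lemma group_congruence_subgroup: "group (congruence_subgroup m :: ('a::comm_ring_1^'n::finite^'n) monoid)"
proof (rule groupI)
  fix A B :: "'a^'n^'n"
  assume "A \<in> carrier (congruence_subgroup m)" and "B \<in> carrier (congruence_subgroup m)"
  then obtain X Y where det: "det A = 1" "det B = 1"
    and AB: "A = mat 1 + mat (of_nat m) ** X" "B = mat 1 + mat (of_nat m) ** Y"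
    by (auto simp: congruence_subgroup_iff)
  have "det (A ** B) = 1" using det by (simp add: det_mul)
  moreover have "A ** B = mat 1 + mat (of_nat m) ** (X + Y + mat (of_nat m) ** (X ** Y))"
    using AB by (simp add: mat_1_plus_mult)
  ultimately show "A \<otimes>\<^bsub>congruence_subgroup m\<^esub> B \<in> carrier (congruence_subgroup m)"
    unfolding congruence_subgroup_iff congruence_subgroup_simps by blast
next
  fix A :: "'a^'n^'n"
  assume "A \<in> carrier (congruence_subgroup m)"
  then obtain X where "det A = 1" and A: "A = mat 1 + mat (of_nat m) ** X"
    by (auto simp: congruence_subgroup_iff)
  obtain B where "det B = 1" and BA: "B ** A = mat 1"
    using det_eq_1_imp_left_inverse[OF \<open>det A = 1\<close>] .
  have "B = B ** A - B ** (mat (of_nat m) ** X)"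
    by (simp add: A matrix_add_ldistrib)
  also have "\<dots> = mat 1 + mat (of_nat m) ** (- (B ** X))"
    by (simp add: BA matrix_mult_mat_commute vec_eq_iff)
  finally have "B \<in> carrier (congruence_subgroup m)"
    using \<open>det B = 1\<close> unfolding congruence_subgroup_iff by blast
  with BA show "\<exists>B\<in>carrier (congruence_subgroup m). B \<otimes>\<^bsub>congruence_subgroup m\<^esub> A = \<one>\<^bsub>congruence_subgroup m\<^esub>"
    by auto
qed (auto simp: congruence_subgroup_iff matrix_mul_assoc intro: exI[of _ 0])

section \<open>Traceless matrices\<close>

lemma sl_add_group_simps:
  "carrier (sl_add_group S) = {M. (\<forall>i j. M i j \<in> carrier S) \<and> finsum S (\<lambda>i. M i i) UNIV = \<zero>\<^bsub>S\<^esub>}"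
  "mult (sl_add_group S) = (\<lambda>M N i j. M i j \<oplus>\<^bsub>S\<^esub> N i j)"
  "one (sl_add_group S) = (\<lambda>i j. \<zero>\<^bsub>S\<^esub>)"
  by (simp_all add: sl_add_group_def)

lemma group_sl_add_group:
  assumes "abelian_group S"
  shows "group (sl_add_group S :: ('n::finite \<Rightarrow> 'n \<Rightarrow> 'b) monoid)"
proof -
  interpret abelian_group S by fact
  note sl_add_group_simps [simp]
  have trace_add: "finsum S (\<lambda>i. M i i \<oplus>\<^bsub>S\<^esub> N i i) UNIV = finsum S (\<lambda>i. M i i) UNIV \<oplus>\<^bsub>S\<^esub> finsum S (\<lambda>i. N i i) UNIV"
    if "\<And>i j. M i j \<in> carrier S" "\<And>i j. N i j \<in> carrier S" for M N :: "'n \<Rightarrow> 'n \<Rightarrow> 'b"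
    using that by (intro finsum_addf) auto
  show ?thesis
  proof (rule groupI)
    fix M N :: "'n \<Rightarrow> 'n \<Rightarrow> 'b"
    assume "M \<in> carrier (sl_add_group S)" "N \<in> carrier (sl_add_group S)"
    then show "M \<otimes>\<^bsub>sl_add_group S\<^esub> N \<in> carrier (sl_add_group S)"
      by (simp add: trace_add)
  next
    show "\<one>\<^bsub>sl_add_group S\<^esub> \<in> carrier (sl_add_group S :: ('n \<Rightarrow> 'n \<Rightarrow> 'b) monoid)"
      by (simp add: finsum_zero)
  next
    fix M N K :: "'n \<Rightarrow> 'n \<Rightarrow> 'b"
    assume "M \<in> carrier (sl_add_group S)" "N \<in> carrier (sl_add_group S)" "K \<in> carrier (sl_add_group S)"
    then show "M \<otimes>\<^bsub>sl_add_group S\<^esub> N \<otimes>\<^bsub>sl_add_group S\<^esub> K =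
        M \<otimes>\<^bsub>sl_add_group S\<^esub> (N \<otimes>\<^bsub>sl_add_group S\<^esub> K)"
      by (simp add: a_assoc)
  next
    fix M :: "'n \<Rightarrow> 'n \<Rightarrow> 'b"
    assume "M \<in> carrier (sl_add_group S)"
    then show "\<one>\<^bsub>sl_add_group S\<^esub> \<otimes>\<^bsub>sl_add_group S\<^esub> M = M"
      by simp
  next
    fix M :: "'n \<Rightarrow> 'n \<Rightarrow> 'b"
    assume M: "M \<in> carrier (sl_add_group S)"
    let ?N = "\<lambda>i j. \<ominus>\<^bsub>S\<^esub> M i j"
    have "finsum S (\<lambda>i. ?N i i) UNIV \<oplus>\<^bsub>S\<^esub> \<zero>\<^bsub>S\<^esub> = finsum S (\<lambda>i. ?N i i \<oplus>\<^bsub>S\<^esub> M i i) UNIV"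
      using M trace_add[of ?N M] by simp
    also have "\<dots> = \<zero>\<^bsub>S\<^esub>"
      using M by (simp add: l_neg)
    finally have "?N \<in> carrier (sl_add_group S)"
      using M by simp
    moreover have "?N \<otimes>\<^bsub>sl_add_group S\<^esub> M = \<one>\<^bsub>sl_add_group S\<^esub>"
      using M by (simp add: l_neg fun_eq_iff)
    ultimately show "\<exists>N\<in>carrier (sl_add_group S). N \<otimes>\<^bsub>sl_add_group S\<^esub> M = \<one>\<^bsub>sl_add_group S\<^esub>"
      by blast
  qed
qed

section \<open>The reduction map\<close>

definition residue_matrix :: "nat \<Rightarrow> 'a::comm_ring_1^'n::finite^'n \<Rightarrow> 'n \<Rightarrow> 'n \<Rightarrow> 'a set" where
  "residue_matrix q X = (\<lambda>i j. residue_class q (X $ i $ j))"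

text \<open>The paper's \<open>\<phi>\<^sub>r\<close> for \<open>m = p\<^sup>r\<close>, \<open>q = p\<close>: it sends \<open>I + m X\<close> to \<open>X mod q\<close>. The matrix \<open>X\<close>
  is unique only when multiplication by \<open>m\<close> is injective, which every lemma about it assumes.\<close>
definition reduction :: "nat \<Rightarrow> nat \<Rightarrow> 'a::comm_ring_1^'n::finite^'n \<Rightarrow> 'n \<Rightarrow> 'n \<Rightarrow> 'a set" where
  "reduction q m A = residue_matrix q (SOME X. A = mat 1 + mat (of_nat m) ** X)"

lemma reduction_eq:
  assumes "inj ((*) (of_nat m :: 'a::comm_ring_1))"
  shows "reduction q m (mat 1 + mat (of_nat m) ** X) = residue_matrix q (X :: 'a^'n::finite^'n)"
proof -
  let ?P = "\<lambda>Y. mat 1 + mat (of_nat m) ** X = mat 1 + mat (of_nat m) ** Y"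
  have "?P (SOME Y. ?P Y)" by (rule someI[of ?P X]) (rule refl)
  then have "mat (of_nat m) ** (SOME Y. ?P Y) = mat (of_nat m) ** X"
    by simp
  then have "(SOME Y. ?P Y) = X"
    by (rule mat_matrix_mult_left_cancel[OF assms])
  then show ?thesis by (simp add: reduction_def)
qed

lemma residue_matrix_eq_iff:
  "residue_matrix q X = residue_matrix q Y \<longleftrightarrow> (\<forall>i j. of_nat q dvd (X - Y) $ i $ j)"
  by (simp add: residue_matrix_def fun_eq_iff residue_class_eq_iff)

lemma residue_matrix_add:
  "residue_matrix q (X + Y) = residue_matrix q X \<otimes>\<^bsub>sl_add_group (mod_p_ring q)\<^esub> residue_matrix q Y"
  by (simp add: sl_add_group_simps residue_matrix_def residue_class_add)

lemma one_sl_add_group_mod_p_ring: "\<one>\<^bsub>sl_add_group (mod_p_ring q)\<^esub> = residue_matrix q (0 :: 'a::comm_ring_1^'n::finite^'n)"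
  by (simp add: sl_add_group_simps residue_matrix_def residue_class_zero)

lemma residue_class_trace:
  "finsum (mod_p_ring q) (\<lambda>i. residue_matrix q X i i) UNIV = residue_class q (trace X)"
  by (simp add: residue_matrix_def trace_def residue_class_sum)

lemma carrier_sl_add_group_mod_p_ring:
  "carrier (sl_add_group (mod_p_ring q)) =
     residue_matrix q ` {X :: 'a::comm_ring_1^'n::finite^'n. of_nat q dvd trace X}"
proof -
  have traceless_iff: "residue_class q (trace X) = \<zero>\<^bsub>mod_p_ring q\<^esub> \<longleftrightarrow> of_nat q dvd trace X" for X :: "'a^'n^'n"
    by (simp add: residue_class_zero[symmetric] residue_class_eq_iff)
  have "M \<in> residue_matrix q ` {X. of_nat q dvd trace X}" if "M \<in> carrier (sl_add_group (mod_p_ring q))" for M :: "'n \<Rightarrow> 'n \<Rightarrow> 'a set"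
  proof -
    from that have "\<exists>x. M i j = residue_class q x" for i j
      by (auto simp: sl_add_group_simps carrier_mod_p_ring image_iff)
    then have entry: "M i j = residue_class q (SOME x. M i j = residue_class q x)" for i j
      by (rule someI_ex)
    define X where "X = (\<chi> i j. SOME x. M i j = residue_class q x)"
    have M: "M = residue_matrix q X"
      unfolding residue_matrix_def X_def by (rule ext, rule ext, simp, rule entry)
    have "residue_class q (trace X) = finsum (mod_p_ring q) (\<lambda>i. M i i) UNIV"
      by (simp add: M residue_class_trace)
    also have "\<dots> = \<zero>\<^bsub>mod_p_ring q\<^esub>"
      using that by (simp add: sl_add_group_simps)
    finally show ?thesis
      using M traceless_iff by blast
  qed
  moreover have "residue_matrix q X \<in> carrier (sl_add_group (mod_p_ring q))" if "of_nat q dvd trace X" for X :: "'a^'n^'n"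
    using that traceless_iff
    by (simp add: sl_add_group_simps residue_class_trace) (simp add: residue_matrix_def carrier_mod_p_ring)
  ultimately show ?thesis by blast
qed

lemma trace_dvd_of_det_eq_1:
  assumes "inj ((*) (of_nat m :: 'a::comm_ring_1))"
    and "det (mat 1 + mat (of_nat m) ** X) = 1"
  shows "of_nat m dvd trace (X :: 'a^'n::finite^'n)"
proof -
  let ?t = "of_nat m :: 'a"
  obtain c where "det (mat 1 + mat ?t ** X) - 1 - ?t * trace X = ?t * ?t * c"
    using det_mat_1_plus_mult_cong[of ?t X] by (auto simp: dvd_def)
  then have "- (?t * trace X) = ?t * ?t * c"
    using assms(2) by simp
  then have "?t * trace X = ?t * (- ?t * c)"
    by (metis add.inverse_inverse mult.assoc mult_minus_left mult_minus_right)
  then have "trace X = - ?t * c"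
    using assms(1) by (simp add: inj_def)
  then show ?thesis by simp
qed

lemma reduction_mem_carrier:
  assumes "inj ((*) (of_nat m :: 'a::comm_ring_1))" and "q dvd m"
    and "A \<in> carrier (congruence_subgroup m :: ('a^'n::finite^'n) monoid)"
  shows "reduction q m A \<in> carrier (sl_add_group (mod_p_ring q))"
proof -
  obtain X where "det (mat 1 + mat (of_nat m) ** X) = 1" and A: "A = mat 1 + mat (of_nat m) ** X"
    using assms(3) by (auto simp: congruence_subgroup_iff)
  moreover have "of_nat q dvd (of_nat m :: 'a)"
    using \<open>q dvd m\<close> by (auto simp: dvd_def)
  ultimately have "of_nat q dvd trace X"
    using trace_dvd_of_det_eq_1[OF assms(1)] dvd_trans by blast
  then show ?thesis
    by (auto simp: A reduction_eq[OF assms(1)] carrier_sl_add_group_mod_p_ring)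
qed

lemma reduction_mult:
  assumes inj: "inj ((*) (of_nat m :: 'a::comm_ring_1))" and "q dvd m"
    and "A \<in> carrier (congruence_subgroup m :: ('a^'n::finite^'n) monoid)"
    and "B \<in> carrier (congruence_subgroup m :: ('a^'n::finite^'n) monoid)"
  shows "reduction q m (A ** B) = reduction q m A \<otimes>\<^bsub>sl_add_group (mod_p_ring q)\<^esub> reduction q m B"
proof -
  obtain X Y where A: "A = mat 1 + mat (of_nat m) ** X" and B: "B = mat 1 + mat (of_nat m) ** Y"
    using assms(3,4) by (auto simp: congruence_subgroup_iff)
  have "of_nat q dvd (of_nat m :: 'a)"
    using \<open>q dvd m\<close> by (auto simp: dvd_def)
  then have "residue_matrix q (X + Y + mat (of_nat m) ** (X ** Y)) = residue_matrix q (X + Y)"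
    unfolding residue_matrix_eq_iff by (simp add: dvd_mult2)
  then show ?thesis
    by (simp add: A B mat_1_plus_mult reduction_eq[OF inj] residue_matrix_add)
qed

lemma reduction_hom:
  assumes "inj ((*) (of_nat m :: 'a::comm_ring_1))" and "q dvd m"
  shows "reduction q m \<in> hom (congruence_subgroup m :: ('a^'n::finite^'n) monoid) (sl_add_group (mod_p_ring q))"
  using reduction_mem_carrier[OF assms] reduction_mult[OF assms] by (intro homI) simp_all

lemma kernel_reduction:
  assumes inj: "inj ((*) (of_nat m :: 'a::comm_ring_1))"
  shows "kernel (congruence_subgroup m :: ('a^'n::finite^'n) monoid) (sl_add_group (mod_p_ring q)) (reduction q m)
      = carrier (congruence_subgroup (m * q))"
proof -
  have trivial_iff: "reduction q m (mat 1 + mat (of_nat m) ** X) = \<one>\<^bsub>sl_add_group (mod_p_ring q)\<^esub>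
      \<longleftrightarrow> (\<exists>Y. X = mat (of_nat q) ** Y)" for X :: "'a^'n^'n"
    by (simp add: reduction_eq[OF inj] one_sl_add_group_mod_p_ring residue_matrix_eq_iff
        entrywise_dvd_iff_mat_mult)
  show ?thesis
  proof (rule Set.set_eqI)
    fix A :: "'a^'n^'n"
    have "A \<in> kernel (congruence_subgroup m) (sl_add_group (mod_p_ring q)) (reduction q m)
        \<longleftrightarrow> det A = 1 \<and> (\<exists>X. A = mat 1 + mat (of_nat m) ** X \<and> (\<exists>Y. X = mat (of_nat q) ** Y))"
      by (auto simp: kernel_def congruence_subgroup_iff trivial_iff)
    also have "\<dots> \<longleftrightarrow> A \<in> carrier (congruence_subgroup (m * q))"
      by (auto simp: congruence_subgroup_iff mat_mult_matrix_mult)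
    finally show "A \<in> kernel (congruence_subgroup m) (sl_add_group (mod_p_ring q)) (reduction q m)
        \<longleftrightarrow> A \<in> carrier (congruence_subgroup (m * q))" .
  qed
qed

section \<open>Surjectivity\<close>

definition liftable :: "nat \<Rightarrow> nat \<Rightarrow> 'a::comm_ring_1^'n::finite^'n \<Rightarrow> bool" where
  "liftable q m X \<longleftrightarrow> residue_matrix q X \<in> reduction q m ` carrier (congruence_subgroup m)"

lemma liftableI:
  assumes "inj ((*) (of_nat m :: 'a::comm_ring_1))" and "det (mat 1 + mat (of_nat m) ** X) = 1"
  shows "liftable q m (X :: 'a^'n::finite^'n)"
proof -
  have "mat 1 + mat (of_nat m) ** X \<in> carrier (congruence_subgroup m)"
    unfolding congruence_subgroup_iff using assms(2) by blast
  then show ?thesis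
    unfolding liftable_def using reduction_eq[OF assms(1), of q X] by (metis image_eqI)
qed

lemma liftable_zero:
  assumes "inj ((*) (of_nat m :: 'a::comm_ring_1))"
  shows "liftable q m (0 :: 'a^'n::finite^'n)"
  by (rule liftableI[OF assms]) simp

lemma liftable_add:
  assumes "inj ((*) (of_nat m :: 'a::comm_ring_1))" and "q dvd m"
    and "liftable q m X" and "liftable q m (Y :: 'a^'n::finite^'n)"
  shows "liftable q m (X + Y)"
proof -
  interpret congruence_subgroup: group "congruence_subgroup m :: ('a^'n^'n) monoid"
    by (rule group_congruence_subgroup)
  obtain A B where A: "A \<in> carrier (congruence_subgroup m)" and B: "B \<in> carrier (congruence_subgroup m)"
    and "residue_matrix q X = reduction q m A" "residue_matrix q Y = reduction q m B"
    using assms(3,4) by (auto simp: liftable_def)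
  then have "residue_matrix q (X + Y) = reduction q m (A ** B)"
    by (simp add: residue_matrix_add reduction_mult[OF assms(1,2)])
  moreover have "A ** B \<in> carrier (congruence_subgroup m)"
    using congruence_subgroup.m_closed[OF A B] by simp
  ultimately show ?thesis
    unfolding liftable_def by blast
qed

lemma liftable_cong:
  assumes "liftable q m X" and "\<forall>i j. of_nat q dvd (Y - X) $ i $ j"
  shows "liftable q m Y"
proof -
  have "residue_matrix q Y = residue_matrix q X"
    using assms(2) by (simp add: residue_matrix_eq_iff)
  with assms(1) show ?thesis by (simp add: liftable_def)
qed

lemma liftable_sum:
  assumes "inj ((*) (of_nat m :: 'a::comm_ring_1))" and "q dvd m"
    and "\<And>s. s \<in> S \<Longrightarrow> liftable q m (f s :: 'a^'n::finite^'n)"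
  shows "liftable q m (sum f S)"
  using assms(3)
proof (induction S rule: infinite_finite_induct)
  case (infinite S)
  then show ?case using liftable_zero[OF assms(1)] by simp
next
  case empty
  then show ?case using liftable_zero[OF assms(1)] by simp
next
  case (insert s S)
  then have "liftable q m (f s)" and "liftable q m (sum f S)" by simp_all
  with insert.hyps show ?case by (simp add: liftable_add[OF assms(1,2)])
qed

lemma liftable_matrix_unit:
  assumes "inj ((*) (of_nat m :: 'a::comm_ring_1))" and "i \<noteq> j"
  shows "liftable q m (matrix_unit i j c :: 'a^'n::finite^'n)"
proof (rule liftableI[OF assms(1)])
  show "det (mat 1 + mat (of_nat m) ** matrix_unit i j c :: 'a^'n^'n) = 1"
    unfolding mat_mult_matrix_unit by (rule det_mat_1_plus_matrix_unit[OF assms(2)])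
qed

text \<open>Transvections only reach off-diagonal entries; the square-zero matrices of
  \<open>det_mat_1_plus_square_zero\<close> supply the traceless diagonal part.\<close>
lemma liftable_diagonal:
  assumes inj: "inj ((*) (of_nat m :: 'a::comm_ring_1))" and "q dvd m" and "i \<noteq> j"
  shows "liftable q m (matrix_unit i i c - matrix_unit j j c :: 'a^'n::finite^'n)"
proof -
  let ?N = "matrix_unit i i c - matrix_unit j j c + matrix_unit i j c - matrix_unit j i c :: 'a^'n^'n"
  let ?t = "of_nat m :: 'a"
  have "mat ?t ** ?N = matrix_unit i i (?t * c) - matrix_unit j j (?t * c) + matrix_unit i j (?t * c) - matrix_unit j i (?t * c)"
    by (simp add: vec_eq_iff right_diff_distrib distrib_left)
  then have "liftable q m ?N"
    using det_mat_1_plus_square_zero[OF \<open>i \<noteq> j\<close>, of "?t * c"] by (intro liftableI[OF inj]) (simp only:)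
  then have "liftable q m (?N + matrix_unit j i c + matrix_unit i j (- c))"
    using assms by (intro liftable_add liftable_matrix_unit) auto
  moreover have "?N + matrix_unit j i c + matrix_unit i j (- c) = matrix_unit i i c - matrix_unit j j c"
    by (simp add: vec_eq_iff)
  ultimately show ?thesis by (simp only:)
qed

lemma liftable_of_trace_dvd:
  assumes inj: "inj ((*) (of_nat m :: 'a::comm_ring_1))" and "q dvd m"
    and "of_nat q dvd trace (X :: 'a^'n::finite^'n)"
  shows "liftable q m X"
proof -
  obtain k :: 'n where True by blast
  define off where "off = (\<Sum>s\<in>{s. fst s \<noteq> snd s}. matrix_unit (fst s) (snd s) (X $ fst s $ snd s) :: 'a^'n^'n)"
  define diag where "diag = (\<Sum>i\<in>UNIV. matrix_unit i i (X $ i $ i) - matrix_unit k k (X $ i $ i) :: 'a^'n^'n)"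
  have "liftable q m off"
    unfolding off_def using inj \<open>q dvd m\<close> by (intro liftable_sum liftable_matrix_unit) auto
  moreover have "liftable q m diag"
    unfolding diag_def
  proof (rule liftable_sum[OF inj \<open>q dvd m\<close>])
    fix i
    show "liftable q m (matrix_unit i i (X $ i $ i) - matrix_unit k k (X $ i $ i) :: 'a^'n^'n)"
      using liftable_zero[OF inj] liftable_diagonal[OF inj \<open>q dvd m\<close>] by (cases "i = k") simp_all
  qed
  ultimately have "liftable q m (off + diag)"
    using inj \<open>q dvd m\<close> by (rule liftable_add[rotated 2])
  moreover have "(X - (off + diag)) $ a $ b = (if a = k \<and> b = k then trace X else 0)" for a b
  proof -
    have "off $ a $ b = (if a \<noteq> b then X $ a $ b else 0)"
      unfolding off_def sum_matrix_units_nth by simp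
    moreover have "diag $ a $ b = (if a = b then X $ a $ a else 0) - (if a = k \<and> b = k then trace X else 0)"
      by (cases "a = b") (auto simp: diag_def sum_component sum_subtractf trace_def intro!: sum.neutral)
    ultimately show ?thesis by simp
  qed
  ultimately show ?thesis
    using \<open>of_nat q dvd trace X\<close> by (elim liftable_cong) simp
qed

lemma reduction_image:
  assumes "inj ((*) (of_nat m :: 'a::comm_ring_1))" and "q dvd m"
  shows "reduction q m ` carrier (congruence_subgroup m :: ('a^'n::finite^'n) monoid) = carrier (sl_add_group (mod_p_ring q))"
proof
  show "reduction q m ` carrier (congruence_subgroup m :: ('a^'n^'n) monoid) \<subseteq> carrier (sl_add_group (mod_p_ring q))"
    using reduction_mem_carrier[OF assms] by blast
  show "carrier (sl_add_group (mod_p_ring q)) \<subseteq> reduction q m ` carrier (congruence_subgroup m :: ('a^'n^'n) monoid)"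
    using liftable_of_trace_dvd[OF assms] unfolding carrier_sl_add_group_mod_p_ring liftable_def by blast
qed

section \<open>The main theorem\<close>

theorem theorem3p2:
  fixes V :: "'a::comm_ring_1 set" and p r :: nat
  assumes "free_Z_basis V"
    and "prime p"
    and "CARD('n::finite) \<ge> 2"
    and "r \<ge> 1"
  shows "\<exists>\<phi>. \<phi> \<in> epi (congruence_subgroup (p ^ r) :: ('a^'n^'n) monoid)
                    (sl_add_group (mod_p_ring p :: 'a set ring) :: ('n \<Rightarrow> 'n \<Rightarrow> 'a set) monoid)
          \<and> kernel (congruence_subgroup (p ^ r)) (sl_add_group (mod_p_ring p)) \<phi>
              = carrier (congruence_subgroup (p ^ (r + 1)))
          \<and> (congruence_subgroup (p ^ r) :: ('a^'n^'n) monoid)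
              Mod carrier (congruence_subgroup (p ^ (r + 1)))
            \<cong> (sl_add_group (mod_p_ring p :: 'a set ring) :: ('n \<Rightarrow> 'n \<Rightarrow> 'a set) monoid)"
proof -
  have inj: "inj ((*) (of_nat (p ^ r) :: 'a))"
    using prime_gt_0_nat[OF assms(2)] by (intro free_Z_basis_inj_mult_of_nat[OF assms(1)]) simp
  have dvd: "p dvd p ^ r"
    using \<open>r \<ge> 1\<close> by (cases r) simp_all
  let ?\<phi> = "reduction p (p ^ r) :: 'a^'n^'n \<Rightarrow> _"
  have hom: "?\<phi> \<in> hom (congruence_subgroup (p ^ r)) (sl_add_group (mod_p_ring p))"
    by (rule reduction_hom[OF inj dvd])
  have onto: "?\<phi> ` carrier (congruence_subgroup (p ^ r)) = carrier (sl_add_group (mod_p_ring p))"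
    by (rule reduction_image[OF inj dvd])
  have kernel: "kernel (congruence_subgroup (p ^ r)) (sl_add_group (mod_p_ring p)) ?\<phi>
      = carrier (congruence_subgroup (p ^ (r + 1)))"
    using kernel_reduction[OF inj, of p] by (simp add: mult.commute)
  have "group (sl_add_group (mod_p_ring p) :: ('n \<Rightarrow> 'n \<Rightarrow> 'a set) monoid)"
    using cring_mod_p_ring by (intro group_sl_add_group ring.is_abelian_group cring.axioms(1))
  then have \<phi>: "group_hom (congruence_subgroup (p ^ r)) (sl_add_group (mod_p_ring p)) ?\<phi>"
    using hom group_congruence_subgroup by (intro group_hom.intro group_hom_axioms.intro)
  note iso = group_hom.FactGroup_iso[OF \<phi> onto, unfolded kernel]
  show ?thesis
    using hom onto kernel iso by (auto simp: epi_def)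
qed

end
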